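(* Consider the Gaussian non-random many-access channel with noise variance $N_0/2=1$ and with $k_n=\mu n$ users at blocklength $n$, all active with probability one. Let $\mathcal{E}^*(M,\mu,\epsilon)$ denote the minimum energy-per-bit required to send $M$ messages per user at an average probability of error (APE) not exceeding $\epsilon\in(0,1)$. Then $$\mathcal{E}^*(2,\mu,\epsilon)=\left(\max\{0,Q^{-1}(\epsilon)\}\right)^2,\qquad 0<\mu\le 1.$$
   Context: $Q$ denotes the tail distribution function of the standard Gaussian distribution and $Q^{-1}$ its inverse. Channel. At blocklength $n$ there are $k_n=\mu n$ users. User $i$ has a message $W_i$; the messages are independent and uniform on $\{1,\ldots,M\}$. User $i$ sends a codeword $\mathbf{x}_i(W_i)\in\mathbb{R}^n$ from its own codebook and the receiver observes $\mathbf{Y}=\sum_{i=1}^{k_n}\mathbf{x}_i(W_i)+\mathbf{Z}$, where $\mathbf{Z}$ has $n$ i.i.d. $\mathcal{N}(0,1)$ components, independent of the messages. Every codeword of every user has energy (squared Euclidean norm) at most $E$. The decoder maps $\mathbf{Y}$ to $(\hat W_1,\ldots,\hat W_{k_n})$. The average probability of error is $P_{e,A}^{(n)}=\frac1{k_n}\sum_{i=1}^{k_n}\Pr\{\hat W_i\ne W_i\}$. The energy-per-bit of such a code is $E/\log_2 M$ (so it equals $E$ when $M=2$), and $\mathcal{E}^*(M,\mu,\epsilon)$ is the smallest energy-per-bit for which $P_{e,A}^{(n)}\le\epsilon$ can be attained. *)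

theory Defs
  imports "HOL-Probability.Probability"
begin

definition Q :: "real \<Rightarrow> real" where
  "Q x = measure std_normal_distribution {x<..}"

text \<open>\<open>Q\<close> is a bijection from the reals onto the open unit interval, so on that interval
  \<open>inv Q\<close> is the genuine inverse function.\<close>

definition Q_inv :: "real \<Rightarrow> real" where
  "Q_inv = inv Q"

text \<open>Users are numbered \<open>1, \<dots>, k\<close> and messages \<open>1, \<dots>, M\<close>. Vectors of length \<open>n\<close> are
  (extensional) functions on \<open>{1..n}\<close>, so that the blocklength can vary inside a formula.
  Codebooks have the form \<open>x i m t\<close>: component \<open>t\<close> of the codeword of user \<open>i\<close> for message \<open>m\<close>.\<close>

definition message_space :: "nat \<Rightarrow> nat \<Rightarrow> (nat \<Rightarrow> nat) measure" where
  "message_space k M = PiM {1..k} (\<lambda>_. uniform_count_measure {1..M})"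

definition noise_space :: "nat \<Rightarrow> (nat \<Rightarrow> real) measure" where
  "noise_space n = PiM {1..n} (\<lambda>_. std_normal_distribution)"

definition channel_space :: "nat \<Rightarrow> nat \<Rightarrow> nat \<Rightarrow> ((nat \<Rightarrow> nat) \<times> (nat \<Rightarrow> real)) measure" where
  "channel_space n k M = message_space k M \<Otimes>\<^sub>M noise_space n"

definition received ::
  "nat \<Rightarrow> nat \<Rightarrow> (nat \<Rightarrow> nat \<Rightarrow> nat \<Rightarrow> real) \<Rightarrow> (nat \<Rightarrow> nat) \<Rightarrow> (nat \<Rightarrow> real) \<Rightarrow> nat \<Rightarrow> real" where
  "received n k x w z = (\<lambda>t\<in>{1..n}. (\<Sum>i=1..k. x i (w i) t) + z t)"

definition is_code ::
  "nat \<Rightarrow> nat \<Rightarrow> nat \<Rightarrow> real \<Rightarrow> (nat \<Rightarrow> nat \<Rightarrow> nat \<Rightarrow> real) \<Rightarrow> ((nat \<Rightarrow> real) \<Rightarrow> nat \<Rightarrow> nat) \<Rightarrow> bool" where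
  "is_code n k M E x g \<longleftrightarrow>
     (\<forall>i\<in>{1..k}. \<forall>m\<in>{1..M}. (\<Sum>t=1..n. (x i m t)\<^sup>2) \<le> E) \<and>
     g \<in> measurable (PiM {1..n} (\<lambda>_. borel)) (PiM {1..k} (\<lambda>_. count_space {1..M}))"

definition average_error_prob ::
  "nat \<Rightarrow> nat \<Rightarrow> nat \<Rightarrow> (nat \<Rightarrow> nat \<Rightarrow> nat \<Rightarrow> real) \<Rightarrow> ((nat \<Rightarrow> real) \<Rightarrow> nat \<Rightarrow> nat) \<Rightarrow> real" where
  "average_error_prob n k M x g =
     (1 / real k) * (\<Sum>i=1..k. measure (channel_space n k M)
        {(w, z) \<in> space (channel_space n k M). g (received n k x w z) i \<noteq> w i})"

definition attainable_energy_per_bit :: "nat \<Rightarrow> nat \<Rightarrow> nat \<Rightarrow> real \<Rightarrow> real set" where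
  "attainable_energy_per_bit n k M \<epsilon> =
     {E / log 2 (real M) | E. \<exists>x g. is_code n k M E x g \<and> average_error_prob n k M x g \<le> \<epsilon>}"

text \<open>The number of users is \<open>\<mu> n\<close> whenever this is an integer; rounding down gives a meaning
  to all other real \<open>\<mu>\<close> and \<open>n\<close>.\<close>

definition num_users :: "real \<Rightarrow> nat \<Rightarrow> nat" where
  "num_users \<mu> n = nat \<lfloor>\<mu> * real n\<rfloor>"

text \<open>The blocklength is not an argument of \<open>\<E>\<^sup>*\<close>: an energy-per-bit counts as attainable if it is
  attainable at all sufficiently large blocklengths.\<close>

definition E_star :: "nat \<Rightarrow> real \<Rightarrow> real \<Rightarrow> real" where
  "E_star M \<mu> \<epsilon> =
     Inf {e. \<forall>\<^sub>F n in sequentially. e \<in> attainable_energy_per_bit n (num_users \<mu> n) M \<epsilon>}"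

end

theory Submission
  imports Defs
begin

text \<open>
  Achievability: as the number of users is at most the blocklength, each user gets a coordinate of
  its own, sends plus or minus \<open>s\<close> on it, and is decoded by its sign with error probability \<open>Q s\<close>.

  Converse: given the messages of all other users, decoding user \<open>i\<close> is a binary test between
  two Gaussian shifts \<open>a\<close>, \<open>b\<close> with the identity covariance. No test beats the half-space
  bounded by the perpendicular bisector of \<open>a\<close> and \<open>b\<close>, whose average error is \<open>Q\<close> at half
  the distance of \<open>a\<close> and \<open>b\<close>, and the energy constraint bounds this half-distance by \<open>sqrt E\<close>.
\<close>

section \<open>The Gaussian tail function and its inverse\<close>

interpretation std_normal: real_distribution std_normal_distribution
  by (rule real_dist_normal_dist)

lemma Q_eq_cdf: "Q x = 1 - cdf std_normal_distribution x"
proof -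
  have "Q x = measure std_normal_distribution (space std_normal_distribution - {..x})"
    unfolding Q_def by (rule arg_cong[where f = "measure _"]) auto
  then show ?thesis
    by (subst (asm) std_normal.prob_compl) (auto simp: cdf_def)
qed

lemma measure_std_normal_singleton: "measure std_normal_distribution {x} = 0"
proof -
  have "emeasure std_normal_distribution {x} = 0"
    by (subst emeasure_density) (auto simp: nn_integral_indicator_singleton')
  then show ?thesis by (simp add: measure_def)
qed

lemma isCont_Q: "isCont Q x"
proof -
  have "isCont (\<lambda>x. 1 - cdf std_normal_distribution x) x"
    using measure_std_normal_singleton std_normal.isCont_cdf by (intro continuous_intros) auto
  then show ?thesis by (simp add: Q_eq_cdf[abs_def])
qed

text \<open>The normal density is positive everywhere, so if \<open>{x<..y}\<close> were null for
  the normal law it would be Lebesgue-null as well, contradicting \<open>x < y\<close>.\<close>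

lemma Q_strict_antimono:
  assumes "x < y"
  shows "Q y < Q x"
proof -
  have "emeasure std_normal_distribution {x<..y} \<noteq> 0"
  proof
    assume "emeasure std_normal_distribution {x<..y} = 0"
    then have "AE t in lborel. ennreal (std_normal_density t) * indicator {x<..y} t = 0"
      by (subst (asm) emeasure_density) (auto simp: nn_integral_0_iff_AE)
    then have "AE t in lborel. t \<notin> {x<..y}"
    proof eventually_elim
      case (elim t)
      then show ?case
        using normal_density_pos[of 1 0 t] by (auto simp: indicator_def ennreal_eq_0_iff split: if_splits)
    qed
    then have "emeasure lborel {x<..y} = 0"
      by (subst (asm) AE_iff_measurable[where N = "{x<..y}"]) auto
    then show False using assms by (simp add: ennreal_eq_0_iff)
  qed
  then have "measure std_normal_distribution {x<..y} > 0"
    by (simp add: std_normal.emeasure_eq_measure less_le)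
  then show ?thesis
    using std_normal.cdf_diff_eq[OF assms] by (simp add: Q_eq_cdf)
qed

lemma Q_le_iff: "Q x \<le> Q y \<longleftrightarrow> y \<le> x"
  by (metis Q_strict_antimono linorder_not_le order_le_less)

text \<open>\<open>inv Q\<close> is a right inverse only on the range of \<open>Q\<close>. The
  limits 1 at minus infinity and 0 at plus infinity, together with continuity and the intermediate
  value theorem, put the whole open unit interval into that range.\<close>

lemma Q_Q_inv:
  assumes "0 < \<epsilon>" "\<epsilon> < 1"
  shows "Q (Q_inv \<epsilon>) = \<epsilon>"
proof -
  have bot: "(Q \<longlongrightarrow> 1 - 0) at_bot" and top: "(Q \<longlongrightarrow> 1 - 1) at_top"
    unfolding Q_eq_cdf[abs_def]
    by (intro tendsto_diff tendsto_const std_normal.cdf_lim_at_bot std_normal.cdf_lim_at_top_prob)+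
  obtain a where a: "Q a > \<epsilon>"
    using order_tendstoD(1)[OF bot, of \<epsilon>] assms by (auto simp: eventually_at_bot_linorder)
  obtain b where b: "Q b < \<epsilon>"
    using order_tendstoD(2)[OF top, of \<epsilon>] assms by (auto simp: eventually_at_top_linorder)
  have "a \<le> b" using a b Q_le_iff[of b a] by auto
  then have "\<exists>x. a \<le> x \<and> x \<le> b \<and> Q x = \<epsilon>"
    using a b isCont_Q by (intro IVT2) auto
  then have "\<epsilon> \<in> range Q" by auto
  then show ?thesis unfolding Q_inv_def by (rule f_inv_into_f)
qed

lemma distributed_std_normal_self: "distributed std_normal_distribution lborel (\<lambda>x. x) std_normal_density"
  by (auto simp: distributed_def intro!: measure_eqI simp: emeasure_distr)

text \<open>The normal law is invariant under negation, and the closed and open half-lines at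
  \<open>- x\<close> differ by a single null point.\<close>

lemma measure_std_normal_atMost: "measure std_normal_distribution {..x} = Q (- x)"
proof -
  have "distributed std_normal_distribution lborel (\<lambda>x. 0 + (- 1) * x) (normal_density (0 + (-1) * 0) (\<bar>-1\<bar> * 1))"
    by (rule std_normal.normal_density_affine[OF distributed_std_normal_self]) auto
  then have eq: "distr std_normal_distribution lborel uminus = std_normal_distribution"
    by (auto dest!: distributed_distr_eq_density)
  have "measure std_normal_distribution {..x} = measure (distr std_normal_distribution lborel uminus) {..x}"
    by (simp add: eq)
  also have "\<dots> = measure std_normal_distribution {- x..}"
    by (subst measure_distr) (auto intro!: arg_cong[where f = "measure _"])
  also have "{- x..} = {- x} \<union> {- x<..}" by auto
  also have "measure std_normal_distribution \<dots> = Q (- x)"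
    by (subst std_normal.finite_measure_Union) (auto simp: measure_std_normal_singleton Q_def)
  finally show ?thesis .
qed

text \<open>The exponents of the two normal densities differ by
  \<open>x\<^sup>2 / 2 - (x - b)\<^sup>2 / 2 = b * x - b\<^sup>2 / 2\<close>. This is the
  one-dimensional factor of the shift formula for the noise vector.\<close>

lemma distr_std_normal_shift:
  "distr std_normal_distribution borel (\<lambda>x. x + b) =
     density std_normal_distribution (\<lambda>x. ennreal (exp (b * x - b\<^sup>2 / 2)))"
proof -
  have "distributed std_normal_distribution lborel (\<lambda>x. b + 1 * x) (normal_density (b + 1 * 0) (\<bar>1\<bar> * 1))"
    by (rule std_normal.normal_density_affine[OF distributed_std_normal_self]) auto
  then have "distr std_normal_distribution lborel (\<lambda>x. x + b) = density lborel (normal_density b 1)"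
    by (auto dest!: distributed_distr_eq_density simp: add.commute)
  also have "\<dots> = density std_normal_distribution (\<lambda>x. ennreal (exp (b * x - b\<^sup>2 / 2)))"
  proof (subst density_density_eq)
    have "normal_density b 1 x = std_normal_density x * exp (b * x - b\<^sup>2 / 2)" for x
      by (simp add: normal_density_def exp_add[symmetric] power2_eq_square field_simps)
    then show "density lborel (normal_density b 1) =
        density lborel (\<lambda>x. ennreal (std_normal_density x) * ennreal (exp (b * x - b\<^sup>2 / 2)))"
      by (simp add: ennreal_mult')
  qed auto
  finally show ?thesis
    by (metis distr_cong sets_lborel)
qed

section \<open>Gaussian noise vectors: shifts and linear functionals\<close>

interpretation std_normal_prod: product_prob_space "\<lambda>_. std_normal_distribution" I for I
  by unfold_locales

lemma sets_noise_space: "sets (noise_space n) = sets (PiM {1..n} (\<lambda>_. borel))"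
  unfolding noise_space_def by (intro sets_PiM_cong) auto

lemma measurable_noise_component [measurable]:
  "t \<in> {1..n} \<Longrightarrow> (\<lambda>z. z t) \<in> borel_measurable (noise_space n)"
  unfolding measurable_cong_sets[OF sets_noise_space refl] by measurable

lemma measurable_shift:
  "(\<lambda>z. \<lambda>t\<in>{1..n}. z t + v t) \<in> measurable (noise_space n) (noise_space n)"
  unfolding measurable_cong_sets[OF refl sets_noise_space]
  by (rule measurable_restrict) measurable

text \<open>Cameron--Martin formula for the noise: a shift amounts to an exponential tilt.\<close>

lemma noise_space_shift:
  "distr (noise_space n) (noise_space n) (\<lambda>z. \<lambda>t\<in>{1..n}. z t + v t) =
     density (noise_space n) (\<lambda>z. ennreal (exp ((\<Sum>t=1..n. v t * z t) - (\<Sum>t=1..n. (v t)\<^sup>2) / 2)))"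
    (is "?D = ?R")
proof -
  interpret shifted: product_sigma_finite "\<lambda>t. distr std_normal_distribution borel (\<lambda>x. x + v t)"
    by (intro product_sigma_finite.intro prob_space_imp_sigma_finite std_normal.prob_space_distr) auto
  have [measurable]: "(\<lambda>z. \<lambda>t\<in>{1..n}. z t + v t) \<in> measurable (noise_space n) (noise_space n)"
    by (rule measurable_shift)
  \<comment> \<open>Both sides are identified with the product \<open>?P\<close> of the
    one-dimensional shifted laws, each time by evaluating on rectangles.\<close>
  let ?P = "PiM {1..n} (\<lambda>t. distr std_normal_distribution borel (\<lambda>x. x + v t))"
  have sets_P: "sets (noise_space n) = sets ?P"
    unfolding noise_space_def by (intro sets_PiM_cong) auto
  have "?D = ?P"
  proof (rule shifted.PiM_eqI)
    fix A assume "\<And>t. t \<in> {1..n} \<Longrightarrow> A t \<in> sets (distr std_normal_distribution borel (\<lambda>x. x + v t))"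
    then have A[measurable]: "\<And>t. t \<in> {1..n} \<Longrightarrow> A t \<in> sets borel" by simp
    have "Pi\<^sub>E {1..n} A \<in> sets (noise_space n)"
      unfolding noise_space_def by (rule sets_PiM_I_finite) auto
    then have "emeasure ?D (Pi\<^sub>E {1..n} A) =
        emeasure (noise_space n) ((\<lambda>z. \<lambda>t\<in>{1..n}. z t + v t) -` Pi\<^sub>E {1..n} A \<inter> space (noise_space n))"
      by (rule emeasure_distr[OF measurable_shift])
    also have "(\<lambda>z. \<lambda>t\<in>{1..n}. z t + v t) -` Pi\<^sub>E {1..n} A \<inter> space (noise_space n) =
        Pi\<^sub>E {1..n} (\<lambda>t. (\<lambda>x. x + v t) -` A t)"
      by (auto simp: noise_space_def space_PiM PiE_iff)
    also have "emeasure (noise_space n) \<dots> = (\<Prod>t\<in>{1..n}. emeasure std_normal_distribution ((\<lambda>x. x + v t) -` A t))"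
      unfolding noise_space_def
      by (subst std_normal_prod.emeasure_PiM) (auto intro!: measurable_sets_borel[OF _ A])
    also have "\<dots> = (\<Prod>t\<in>{1..n}. emeasure (distr std_normal_distribution borel (\<lambda>x. x + v t)) (A t))"
      by (intro prod.cong refl) (subst emeasure_distr, auto)
    finally show "emeasure ?D (Pi\<^sub>E {1..n} A) = \<dots>" .
  qed (auto simp: sets_P)
  moreover have "?R = ?P"
  proof (rule shifted.PiM_eqI)
    fix A assume "\<And>t. t \<in> {1..n} \<Longrightarrow> A t \<in> sets (distr std_normal_distribution borel (\<lambda>x. x + v t))"
    then have A[measurable]: "\<And>t. t \<in> {1..n} \<Longrightarrow> A t \<in> sets borel" by simp
    have [measurable]: "Pi\<^sub>E {1..n} A \<in> sets (noise_space n)"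
      unfolding noise_space_def by (rule sets_PiM_I_finite) auto
    have "emeasure ?R (Pi\<^sub>E {1..n} A) = (\<integral>\<^sup>+z. ennreal (exp ((\<Sum>t=1..n. v t * z t) - (\<Sum>t=1..n. (v t)\<^sup>2) / 2)) *
        indicator (Pi\<^sub>E {1..n} A) z \<partial>noise_space n)"
      by (rule emeasure_density) measurable
    \<comment> \<open>The exponential tilt and the indicator of a rectangle both factor over the
      coordinates, so the integral splits into one-dimensional ones.\<close>
    also have "\<dots> = (\<integral>\<^sup>+z. (\<Prod>t\<in>{1..n}. ennreal (exp (v t * z t - (v t)\<^sup>2 / 2)) * indicator (A t) (z t)) \<partial>noise_space n)"
    proof (rule nn_integral_cong)
      fix z assume "z \<in> space (noise_space n)"
      then have "indicator (Pi\<^sub>E {1..n} A) z = (\<Prod>t\<in>{1..n}. indicator (A t) (z t) :: ennreal)"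
        by (auto simp: noise_space_def space_PiM PiE_iff indicator_def prod_zero_iff)
      moreover have "exp ((\<Sum>t=1..n. v t * z t) - (\<Sum>t=1..n. (v t)\<^sup>2) / 2) = (\<Prod>t\<in>{1..n}. exp (v t * z t - (v t)\<^sup>2 / 2))"
        by (simp add: exp_sum[symmetric] sum_subtractf sum_divide_distrib)
      ultimately show "ennreal (exp ((\<Sum>t=1..n. v t * z t) - (\<Sum>t=1..n. (v t)\<^sup>2) / 2)) * indicator (Pi\<^sub>E {1..n} A) z =
          (\<Prod>t\<in>{1..n}. ennreal (exp (v t * z t - (v t)\<^sup>2 / 2)) * indicator (A t) (z t))"
        by (simp add: prod.distrib prod_ennreal)
    qed
    also have "\<dots> = (\<Prod>t\<in>{1..n}. \<integral>\<^sup>+x. ennreal (exp (v t * x - (v t)\<^sup>2 / 2)) * indicator (A t) x \<partial>std_normal_distribution)"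
      unfolding noise_space_def by (rule std_normal_prod.product_nn_integral_prod) auto
    also have "\<dots> = (\<Prod>t\<in>{1..n}. emeasure (distr std_normal_distribution borel (\<lambda>x. x + v t)) (A t))"
      by (intro prod.cong refl, subst distr_std_normal_shift, subst emeasure_density) auto
    finally show "emeasure ?R (Pi\<^sub>E {1..n} A) = \<dots>" .
  qed (auto simp: sets_P)
  ultimately show ?thesis by simp
qed

interpretation noise: prob_space "noise_space n" for n
  unfolding noise_space_def by (rule prob_space_PiM) unfold_locales

lemma distr_noise_component:
  assumes "t \<in> {1..n}"
  shows "distr (noise_space n) borel (\<lambda>z. z t) = std_normal_distribution"
proof -
  have "distr (noise_space n) borel (\<lambda>z. z t) = distr (noise_space n) std_normal_distribution (\<lambda>z. z t)"
    by (rule distr_cong) auto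
  then show ?thesis
    unfolding noise_space_def using std_normal_prod.PiM_component[OF assms] by simp
qed

text \<open>Independence is read off from the joint law being the product of the marginals, a
  criterion for non-empty index sets; hence \<open>n \<ge> 1\<close>.\<close>

lemma indep_vars_noise:
  assumes "n \<ge> 1"
  shows "noise.indep_vars n (\<lambda>_. borel) (\<lambda>t z. z t) {1..n}"
proof (subst noise.indep_vars_iff_distr_eq_PiM')
  have "distr (noise_space n) (PiM {1..n} (\<lambda>_. borel)) (\<lambda>z. \<lambda>t\<in>{1..n}. z t) =
      distr (noise_space n) (noise_space n) (\<lambda>z. z)"
    by (rule distr_cong) (simp_all only: sets_noise_space, auto simp: noise_space_def space_PiM)
  also have "\<dots> = noise_space n" by simp
  also have "\<dots> = PiM {1..n} (\<lambda>t. distr (noise_space n) borel (\<lambda>z. z t))"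
    by (subst noise_space_def, rule PiM_cong) (simp_all only: distr_noise_component)
  finally show "distr (noise_space n) (PiM {1..n} (\<lambda>_. borel)) (\<lambda>z. \<lambda>t\<in>{1..n}. z t) =
      PiM {1..n} (\<lambda>t. distr (noise_space n) borel (\<lambda>z. z t))" .
qed (use assms in auto)

lemma distr_noise_weighted_sum:
  fixes v :: "nat \<Rightarrow> real" and n :: nat
  defines "\<sigma> \<equiv> sqrt (\<Sum>t=1..n. (v t)\<^sup>2)"
  assumes "\<sigma> > 0"
  shows "distr (noise_space n) borel (\<lambda>z. (\<Sum>t=1..n. v t * z t) / \<sigma>) = std_normal_distribution"
proof -
  \<comment> \<open>A coordinate of weight 0 contributes a point mass, which has no normal density.
    The sum is therefore taken over the non-zero weights only.\<close>
  define J where "J = {t \<in> {1..n}. v t \<noteq> 0}"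
  have J: "finite J" "J \<subseteq> {1..n}" by (auto simp: J_def)
  have \<sigma>: "\<sigma> = sqrt (\<Sum>t\<in>J. \<bar>v t\<bar>\<^sup>2)"
    unfolding \<sigma>_def J_def by (auto intro!: sum.mono_neutral_right arg_cong[where f = sqrt])
  then have "J \<noteq> {}" using assms by auto
  then have n: "n \<ge> 1" by (auto simp: J_def)
  have coord: "distributed (noise_space n) lborel (\<lambda>z. z t) std_normal_density" if "t \<in> J" for t
  proof -
    have t: "t \<in> {1..n}" using that J by blast
    have "distr (noise_space n) lborel (\<lambda>z. z t) = distr (noise_space n) borel (\<lambda>z. z t)"
      by (rule distr_cong) auto
    then show ?thesis
      using measurable_noise_component[OF t]
      by (simp add: distributed_def distr_noise_component[OF t])
  qed
  have "distributed (noise_space n) lborel (\<lambda>z. v t * z t) (normal_density 0 \<bar>v t\<bar>)" if "t \<in> J" for t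
    using noise.normal_density_affine[OF coord[OF that], of "v t" 0] that by (simp add: J_def)
  moreover have "noise.indep_vars n (\<lambda>_. borel) (\<lambda>t z. v t * z t) J"
    by (rule noise.indep_vars_compose2[OF noise.indep_vars_subset[OF indep_vars_noise[OF n] J(2)]]) auto
  ultimately have "distributed (noise_space n) lborel (\<lambda>z. \<Sum>t\<in>J. v t * z t) (normal_density (\<Sum>t\<in>J. 0) \<sigma>)"
    unfolding \<sigma> using \<open>J \<noteq> {}\<close> J by (intro noise.sum_indep_normal) (auto simp: J_def)
  also have "(\<lambda>z. \<Sum>t\<in>J. v t * z t) = (\<lambda>z. \<Sum>t=1..n. v t * z t)"
    by (auto simp: J_def fun_eq_iff intro!: sum.mono_neutral_left)
  finally have "distributed (noise_space n) lborel (\<lambda>z. 0 + (1 / \<sigma>) * (\<Sum>t=1..n. v t * z t))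
      (normal_density (0 + (1 / \<sigma>) * 0) (\<bar>1 / \<sigma>\<bar> * \<sigma>))"
    using assms by (intro noise.normal_density_affine) auto
  then have "distr (noise_space n) lborel (\<lambda>z. (\<Sum>t=1..n. v t * z t) / \<sigma>) = std_normal_distribution"
    using assms by (auto dest!: distributed_distr_eq_density)
  moreover have "distr (noise_space n) borel f = distr (noise_space n) lborel f" for f :: "_ \<Rightarrow> real"
    by (rule distr_cong) auto
  ultimately show ?thesis by simp
qed

text \<open>Moves the shift from the event into the integrand, so that error probabilities under
  different means become integrals against the same measure and can be compared pointwise.\<close>

lemma emeasure_noise_shift:
  assumes "C \<in> sets (noise_space n)"
  shows "emeasure (noise_space n) {z \<in> space (noise_space n). (\<lambda>t\<in>{1..n}. z t + v t) \<in> C} =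
    (\<integral>\<^sup>+z. ennreal (exp ((\<Sum>t=1..n. v t * z t) - (\<Sum>t=1..n. (v t)\<^sup>2) / 2)) * indicator C z \<partial>noise_space n)"
proof -
  have "{z \<in> space (noise_space n). (\<lambda>t\<in>{1..n}. z t + v t) \<in> C} =
      (\<lambda>z. \<lambda>t\<in>{1..n}. z t + v t) -` C \<inter> space (noise_space n)" by auto
  also have "emeasure (noise_space n) \<dots> =
      emeasure (distr (noise_space n) (noise_space n) (\<lambda>z. \<lambda>t\<in>{1..n}. z t + v t)) C"
    by (rule emeasure_distr[OF measurable_shift assms, symmetric])
  also have "\<dots> = (\<integral>\<^sup>+z. ennreal (exp ((\<Sum>t=1..n. v t * z t) - (\<Sum>t=1..n. (v t)\<^sup>2) / 2)) *
      indicator C z \<partial>noise_space n)"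
    unfolding noise_space_shift by (rule emeasure_density[OF _ assms]) measurable
  finally show ?thesis .
qed

lemma emeasure_weighted_sum:
  fixes v :: "nat \<Rightarrow> real" and n :: nat
  defines "\<sigma> \<equiv> sqrt (\<Sum>t=1..n. (v t)\<^sup>2)"
  assumes "\<sigma> > 0" "B \<in> sets borel"
  shows "emeasure (noise_space n) {z \<in> space (noise_space n). (\<Sum>t=1..n. v t * z t) / \<sigma> \<in> B} =
    emeasure std_normal_distribution B"
proof -
  have "emeasure std_normal_distribution B =
      emeasure (distr (noise_space n) borel (\<lambda>z. (\<Sum>t=1..n. v t * z t) / \<sigma>)) B"
    unfolding \<sigma>_def by (subst distr_noise_weighted_sum) (use assms in auto)
  also have "\<dots> = emeasure (noise_space n) ((\<lambda>z. (\<Sum>t=1..n. v t * z t) / \<sigma>) -` B \<inter> space (noise_space n))"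
    by (rule emeasure_distr) (use assms in measurable)
  also have "(\<lambda>z. (\<Sum>t=1..n. v t * z t) / \<sigma>) -` B \<inter> space (noise_space n) =
      {z \<in> space (noise_space n). (\<Sum>t=1..n. v t * z t) / \<sigma> \<in> B}" by auto
  finally show ?thesis by simp
qed

section \<open>Binary testing between two Gaussian shifts\<close>

lemma Q_nonneg: "0 \<le> Q x"
  by (simp add: Q_def)

text \<open>The noise is centred at \<open>v\<close> or at \<open>- v\<close>, and \<open>B\<close>
  is the region deciding for \<open>v\<close>; the right-hand side is the sum of the two errors. It
  is smallest for the half-space \<open>T\<close> of points with positive inner product with
  \<open>v\<close>, where the bound is an equality.\<close>

lemma antipodal_test_error:
  fixes v :: "nat \<Rightarrow> real"
  assumes B: "B \<in> sets (noise_space n)"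
  shows "2 * ennreal (Q (sqrt (\<Sum>t=1..n. (v t)\<^sup>2))) \<le>
    emeasure (noise_space n) {z \<in> space (noise_space n). (\<lambda>t\<in>{1..n}. z t + v t) \<in> space (noise_space n) - B} +
    emeasure (noise_space n) {z \<in> space (noise_space n). (\<lambda>t\<in>{1..n}. z t + - v t) \<in> B}"
proof -
  let ?N = "noise_space n" and ?S = "\<lambda>z. \<Sum>t=1..n. v t * z t"
  define \<sigma> where "\<sigma> = sqrt (\<Sum>t=1..n. (v t)\<^sup>2)"
  define T where "T = {z \<in> space ?N. ?S z > 0}"
  have T: "T \<in> sets ?N" unfolding T_def by measurable
  have sq: "\<sigma>\<^sup>2 = (\<Sum>t=1..n. (v t)\<^sup>2)" unfolding \<sigma>_def by (simp add: sum_nonneg)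
  have \<sigma>0: "\<sigma> \<ge> 0" unfolding \<sigma>_def by (simp add: sum_nonneg)
  \<comment> \<open>For any decision region the total error is a single integral that picks, at each
    \<open>z\<close>, one of the two tilts; this makes the optimal region visible.\<close>
  have err: "emeasure ?N {z \<in> space ?N. (\<lambda>t\<in>{1..n}. z t + v t) \<in> space ?N - C} +
      emeasure ?N {z \<in> space ?N. (\<lambda>t\<in>{1..n}. z t + - v t) \<in> C} =
      (\<integral>\<^sup>+z. ennreal (exp (?S z - \<sigma>\<^sup>2 / 2)) * indicator (space ?N - C) z +
        ennreal (exp (- ?S z - \<sigma>\<^sup>2 / 2)) * indicator C z \<partial>?N)" if C[measurable]: "C \<in> sets ?N" for C
    unfolding emeasure_noise_shift[OF C, of "\<lambda>t. - v t"]
      emeasure_noise_shift[OF sets.compl_sets[OF C], of v]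
    by (subst nn_integral_add) (simp_all add: sq sum_negf)
  have space_shift: "(\<lambda>t\<in>{1..n}. z t + u t) \<in> space ?N" for z u
    by (auto simp: noise_space_def space_PiM)
  have S_plus: "?S (\<lambda>t\<in>{1..n}. z t + v t) = ?S z + \<sigma>\<^sup>2"
    and S_minus: "?S (\<lambda>t\<in>{1..n}. z t + - v t) = ?S z - \<sigma>\<^sup>2" for z
    using sq by (simp_all add: sum.distrib sum_subtractf distrib_left right_diff_distrib power2_eq_square)
  \<comment> \<open>The total error of \<open>T\<close>: under the means \<open>v\<close> and
    \<open>- v\<close> the statistic \<open>?S\<close> is centred at \<open>\<sigma>\<^sup>2\<close>
    and \<open>- \<sigma>\<^sup>2\<close> and has standard deviation
    \<open>\<sigma>\<close>.\<close>
  have "2 * ennreal (Q \<sigma>) = emeasure ?N {z \<in> space ?N. ?S z + \<sigma>\<^sup>2 \<le> 0} + emeasure ?N {z \<in> space ?N. ?S z - \<sigma>\<^sup>2 > 0}"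
  proof (cases "\<sigma> = 0")
    \<comment> \<open>Here \<open>?S\<close> cannot be normalised. It vanishes identically, so
      \<open>T\<close> is empty and its two errors are 1 and 0, in agreement with
      \<open>2 * Q 0 = 1\<close>.\<close>
    case True
    then have "v t = 0" if "t \<in> {1..n}" for t
      using that sq by (auto simp: sum_nonneg_eq_0_iff)
    then have "?S z = 0" for z by simp
    moreover have "2 * ennreal (Q 0) = 1"
    proof -
      have "Q 0 = 1 / 2"
        using Q_eq_cdf[of 0] measure_std_normal_atMost[of 0] by (simp add: cdf_def)
      then show ?thesis
        using ennreal_mult[of 2 "1 / 2"] by (simp only:) simp
    qed
    ultimately show ?thesis
      using True by (simp add: noise.emeasure_space_1)
  next
    case False
    then have pos: "\<sigma> > 0" using \<sigma>0 by simp
    have "{z \<in> space ?N. ?S z + \<sigma>\<^sup>2 \<le> 0} = {z \<in> space ?N. ?S z / \<sigma> \<in> {..-\<sigma>}}"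
      "{z \<in> space ?N. ?S z - \<sigma>\<^sup>2 > 0} = {z \<in> space ?N. ?S z / \<sigma> \<in> {\<sigma><..}}"
      using pos by (auto simp: field_simps power2_eq_square)
    moreover have "emeasure ?N {z \<in> space ?N. ?S z / \<sigma> \<in> {..-\<sigma>}} = ennreal (Q \<sigma>)"
      "emeasure ?N {z \<in> space ?N. ?S z / \<sigma> \<in> {\<sigma><..}} = ennreal (Q \<sigma>)"
      using emeasure_weighted_sum[of v n "{..-\<sigma>}", folded \<sigma>_def, OF pos]
        emeasure_weighted_sum[of v n "{\<sigma><..}", folded \<sigma>_def, OF pos]
      by (simp_all add: std_normal.emeasure_eq_measure measure_std_normal_atMost Q_def)
    ultimately show ?thesis
      by (simp only: mult_2)
  qed
  also have "\<dots> = emeasure ?N {z \<in> space ?N. (\<lambda>t\<in>{1..n}. z t + v t) \<in> space ?N - T} +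
      emeasure ?N {z \<in> space ?N. (\<lambda>t\<in>{1..n}. z t + - v t) \<in> T}"
    unfolding T_def by (simp only: mem_Collect_eq Diff_iff space_shift S_plus S_minus simp_thms not_less)
  \<comment> \<open>Neyman--Pearson: \<open>T\<close> puts each \<open>z\<close> on the side of the smaller of the two densities.\<close>
  also have "\<dots> \<le> emeasure ?N {z \<in> space ?N. (\<lambda>t\<in>{1..n}. z t + v t) \<in> space ?N - B} +
      emeasure ?N {z \<in> space ?N. (\<lambda>t\<in>{1..n}. z t + - v t) \<in> B}"
    unfolding err[OF T] err[OF B]
    by (rule nn_integral_mono) (auto simp: T_def indicator_def)
  finally show ?thesis by (simp add: \<sigma>_def)
qed

text \<open>Translating by the midpoint \<open>u\<close> of \<open>a\<close> and \<open>b\<close>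
  reduces this to the antipodal test with \<open>v\<close> half their difference; the decision
  region is translated along with them.\<close>

lemma binary_test_error:
  fixes a b :: "nat \<Rightarrow> real"
  assumes B: "B \<in> sets (noise_space n)"
  shows "2 * ennreal (Q (sqrt (\<Sum>t=1..n. (a t - b t)\<^sup>2) / 2)) \<le>
    emeasure (noise_space n) {z \<in> space (noise_space n). (\<lambda>t\<in>{1..n}. z t + a t) \<in> space (noise_space n) - B} +
    emeasure (noise_space n) {z \<in> space (noise_space n). (\<lambda>t\<in>{1..n}. z t + b t) \<in> B}"
proof -
  let ?N = "noise_space n"
  define v where "v t = (a t - b t) / 2" for t
  define u where "u t = (a t + b t) / 2" for t
  define B' where "B' = {z \<in> space ?N. (\<lambda>t\<in>{1..n}. z t + u t) \<in> B}"
  have B': "B' \<in> sets ?N"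
    unfolding B'_def using measurable_sets[OF measurable_shift B, of u]
    by (simp add: vimage_def Int_def conj_commute)
  have space_shift: "(\<lambda>t\<in>{1..n}. z t + c t) \<in> space ?N" for z c
    by (auto simp: noise_space_def space_PiM)
  have comp: "(\<lambda>t\<in>{1..n}. (\<lambda>t\<in>{1..n}. z t + v t) t + u t) = (\<lambda>t\<in>{1..n}. z t + a t)"
    "(\<lambda>t\<in>{1..n}. (\<lambda>t\<in>{1..n}. z t + - v t) t + u t) = (\<lambda>t\<in>{1..n}. z t + b t)" for z
    by (auto simp: v_def u_def field_simps restrict_def)
  have "(\<Sum>t=1..n. (v t)\<^sup>2) = (\<Sum>t=1..n. (a t - b t)\<^sup>2) / 2\<^sup>2"
    by (simp add: v_def power_divide sum_divide_distrib)
  then have "sqrt (\<Sum>t=1..n. (v t)\<^sup>2) = sqrt (\<Sum>t=1..n. (a t - b t)\<^sup>2) / 2"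
    by (simp only: real_sqrt_divide) simp
  then show ?thesis
    using antipodal_test_error[OF B', of v] unfolding B'_def
    by (simp only: mem_Collect_eq Diff_iff space_shift comp simp_thms)
qed

section \<open>The channel: measurability and conditioning on the messages\<close>

interpretation message: prob_space "message_space k 2" for k
  unfolding message_space_def by (intro prob_space_PiM prob_space_uniform_count_measure) auto

lemma measurable_message_component:
  assumes "i \<in> {1..k}"
  shows "(\<lambda>w. w i) \<in> measurable (message_space k M) (count_space {1..M})"
  unfolding message_space_def
  using measurable_component_singleton[OF assms, of "\<lambda>_. uniform_count_measure {1..M}"]
  by (simp only: measurable_cong_sets[OF refl sets_uniform_count_measure_count_space])

lemma measurable_received:
  "(\<lambda>(w, z). received n k x w z) \<in> measurable (channel_space n k M) (PiM {1..n} (\<lambda>_. borel))"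
proof -
  have "(\<lambda>w. x i (w i) t) \<in> borel_measurable (message_space k M)" if "i \<in> {1..k}" for i t
    by (rule measurable_compose[OF measurable_message_component[OF that]]) simp
  then show ?thesis
    unfolding received_def channel_space_def split_beta'
    by (intro measurable_restrict borel_measurable_add borel_measurable_sum
      measurable_compose[OF measurable_fst] measurable_compose[OF measurable_snd]
      measurable_noise_component)
qed

text \<open>The event whose probability \<open>average_error_prob\<close> sums over the users, named
  so that its measurability can be stated.\<close>

definition error_event ::
  "nat \<Rightarrow> nat \<Rightarrow> nat \<Rightarrow> (nat \<Rightarrow> nat \<Rightarrow> nat \<Rightarrow> real) \<Rightarrow> ((nat \<Rightarrow> real) \<Rightarrow> nat \<Rightarrow> nat) \<Rightarrow> nat \<Rightarrow>
    ((nat \<Rightarrow> nat) \<times> (nat \<Rightarrow> real)) set" where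
  "error_event n k M x g i =
     {(w, z) \<in> space (channel_space n k M). g (received n k x w z) i \<noteq> w i}"

lemma sets_error_event:
  assumes g: "g \<in> measurable (PiM {1..n} (\<lambda>_. borel)) (PiM {1..k} (\<lambda>_. count_space {1..M}))"
    and i: "i \<in> {1..k}"
  shows "error_event n k M x g i \<in> sets (channel_space n k M)"
proof -
  let ?C = "channel_space n k M"
  have [measurable]: "(\<lambda>p. g (received n k x (fst p) (snd p)) i) \<in> measurable ?C (count_space {1..M})"
    using measurable_compose[OF measurable_compose[OF measurable_received g]
      measurable_component_singleton[OF i]] by (simp add: split_beta')
  have [measurable]: "(\<lambda>p. fst p i) \<in> measurable ?C (count_space {1..M})"
    unfolding channel_space_def
    by (rule measurable_compose[OF measurable_fst measurable_message_component[OF i]])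
  \<comment> \<open>Splitting by the finitely many values of the message replaces the comparison of
    two random quantities by comparisons with constants.\<close>
  have "error_event n k M x g i = {p \<in> space ?C. \<exists>m\<in>{1..M}. fst p i = m \<and> g (received n k x (fst p) (snd p)) i \<noteq> m}"
    using measurable_space[OF \<open>(\<lambda>p. fst p i) \<in> measurable ?C (count_space {1..M})\<close>]
    unfolding error_event_def by fastforce
  also have "\<dots> \<in> sets ?C" by measurable
  finally show ?thesis .
qed

text \<open>Fubini: the inner measure is the conditional error probability given all messages, by
  independence of messages and noise.\<close>

lemma emeasure_error_event:
  assumes "g \<in> measurable (PiM {1..n} (\<lambda>_. borel)) (PiM {1..k} (\<lambda>_. count_space {1..M}))" "i \<in> {1..k}"
  shows "emeasure (channel_space n k M) (error_event n k M x g i) =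
    (\<integral>\<^sup>+w. emeasure (noise_space n) {z \<in> space (noise_space n). g (received n k x w z) i \<noteq> w i} \<partial>message_space k M)"
  using sets_error_event[OF assms, of x] unfolding channel_space_def
  by (subst noise.emeasure_pair_measure_alt)
    (auto simp: error_event_def channel_space_def space_pair_measure intro!: nn_integral_cong arg_cong[where f = "emeasure _"])

lemma measurable_conditional_error:
  assumes "g \<in> measurable (PiM {1..n} (\<lambda>_. borel)) (PiM {1..k} (\<lambda>_. count_space {1..M}))" "i \<in> {1..k}"
  shows "(\<lambda>w. emeasure (noise_space n) {z \<in> space (noise_space n). g (received n k x w z) i \<noteq> w i})
    \<in> borel_measurable (message_space k M)"
proof -
  have "(\<lambda>w. emeasure (noise_space n) (Pair w -` error_event n k M x g i)) \<in> borel_measurable (message_space k M)"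
    using sets_error_event[OF assms, of x] unfolding channel_space_def
    by (rule noise.measurable_emeasure_Pair)
  then show ?thesis
    by (rule measurable_cong[THEN iffD1, rotated])
      (auto simp: error_event_def channel_space_def space_pair_measure intro!: arg_cong[where f = "emeasure _"])
qed

interpretation channel: prob_space "channel_space n k 2" for n k
proof -
  interpret pair_prob_space "message_space k 2" "noise_space n" ..
  show "prob_space (channel_space n k 2)"
    unfolding channel_space_def by (rule prob_space_axioms)
qed

section \<open>Converse: a lower bound on the error of each user\<close>

lemma user_error_ge:
  assumes code: "is_code n k 2 E x g" and i: "i \<in> {1..k}"
  shows "Q (sqrt E) \<le> measure (channel_space n k 2) (error_event n k 2 x g i)"
proof -
  let ?N = "noise_space n" and ?U = "uniform_count_measure {1..2::nat}"
  have g: "g \<in> measurable (PiM {1..n} (\<lambda>_. borel)) (PiM {1..k} (\<lambda>_. count_space {1..2}))"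
    using code by (simp add: is_code_def)
  define F where "F w = emeasure ?N {z \<in> space ?N. g (received n k x w z) i \<noteq> w i}" for w
  have half_dist_le: "sqrt (\<Sum>t=1..n. (x i 1 t - x i 2 t)\<^sup>2) / 2 \<le> sqrt E"
  proof -
    have "(\<Sum>t=1..n. (x i 1 t - x i 2 t)\<^sup>2) \<le> (\<Sum>t=1..n. 2 * (x i 1 t)\<^sup>2 + 2 * (x i 2 t)\<^sup>2)"
    proof (rule sum_mono)
      fix t
      show "(x i 1 t - x i 2 t)\<^sup>2 \<le> 2 * (x i 1 t)\<^sup>2 + 2 * (x i 2 t)\<^sup>2"
        \<comment> \<open>The right side minus the left side is the square of the sum of the two
          components.\<close>
        using zero_le_power2[of "x i 1 t + x i 2 t"] by (simp add: power2_eq_square algebra_simps)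
    qed
    also have "\<dots> = 2 * (\<Sum>t=1..n. (x i 1 t)\<^sup>2) + 2 * (\<Sum>t=1..n. (x i 2 t)\<^sup>2)"
      by (simp add: sum.distrib sum_distrib_left)
    also have "\<dots> \<le> 2 * E + 2 * E"
      using code i by (intro add_mono mult_left_mono) (auto simp: is_code_def)
    also have "\<dots> = 2\<^sup>2 * E" by simp
    finally have "sqrt (\<Sum>t=1..n. (x i 1 t - x i 2 t)\<^sup>2) \<le> sqrt (2\<^sup>2 * E)"
      by (rule real_sqrt_le_mono)
    then show ?thesis by (simp only: real_sqrt_mult) simp
  qed
  interpret uniform: product_prob_space "\<lambda>_::nat. ?U" I for I
    by (intro product_prob_space.intro product_sigma_finite.intro product_prob_space_axioms.intro
      prob_space_imp_sigma_finite prob_space_uniform_count_measure) auto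
  have insert: "insert i ({1..k} - {i}) = {1..k}" using i by auto
  \<comment> \<open>The messages of the other users are frozen in \<open>w\<close>; only that of
    user \<open>i\<close> is averaged, and the value \<open>w i\<close> is overwritten.\<close>
  have F_ge: "ennreal (Q (sqrt E)) \<le> (\<integral>\<^sup>+m. F (w(i := m)) \<partial>?U)" for w
  proof -
    \<comment> \<open>The interference from the other users: a fixed translation common to both
      hypotheses, which cancels in the difference \<open>a t - b t\<close>.\<close>
    define c where "c t = (\<Sum>j\<in>{1..k} - {i}. x j (w j) t)" for t
    have received: "received n k x (w(i := m)) z = (\<lambda>t\<in>{1..n}. z t + (c t + x i m t))" for m z
    proof -
      have "(\<Sum>j=1..k. x j ((w(i := m)) j) t) = x i m t + c t" for t
        unfolding c_def using sum.remove[OF _ i, of "\<lambda>j. x j ((w(i := m)) j) t"] by simp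
      then show ?thesis unfolding received_def by (simp add: add_ac)
    qed
    define B where "B = {y \<in> space ?N. g y i = 1}"
    have gi: "(\<lambda>y. g y i) \<in> measurable ?N (count_space {1..2})"
      unfolding measurable_cong_sets[OF sets_noise_space refl]
      by (rule measurable_compose[OF g measurable_component_singleton[OF i]])
    then have B: "B \<in> sets ?N" unfolding B_def by measurable
    have space_shift: "(\<lambda>t\<in>{1..n}. z t + a t) \<in> space ?N" for z a
      by (auto simp: noise_space_def space_PiM)
    \<comment> \<open>The decoder takes only the values 1 and 2, so its errors under the two
      messages are governed by a single region \<open>B\<close> and its complement.\<close>
    have "g y i \<noteq> 2 \<longleftrightarrow> g y i = 1" if "y \<in> space ?N" for y
      using measurable_space[OF gi that] by auto
    then have F2: "F (w(i := 2)) = emeasure ?N {z \<in> space ?N. (\<lambda>t\<in>{1..n}. z t + (c t + x i 2 t)) \<in> B}"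
      unfolding F_def received B_def using space_shift by simp
    have F1: "F (w(i := 1)) = emeasure ?N {z \<in> space ?N. (\<lambda>t\<in>{1..n}. z t + (c t + x i 1 t)) \<in> space ?N - B}"
      unfolding F_def received B_def using space_shift by simp
    have "2 * ennreal (Q (sqrt E)) \<le> 2 * ennreal (Q (sqrt (\<Sum>t=1..n. (x i 1 t - x i 2 t)\<^sup>2) / 2))"
      using half_dist_le by (intro mult_left_mono ennreal_leI) (simp_all add: Q_le_iff)
    also have "\<dots> \<le> F (w(i := 1)) + F (w(i := 2))"
      unfolding F1 F2 using binary_test_error[OF B, of "\<lambda>t. c t + x i 1 t" "\<lambda>t. c t + x i 2 t"] by simp
    finally have "ennreal (1 / 2) * (2 * ennreal (Q (sqrt E))) \<le> ennreal (1 / 2) * (F (w(i := 1)) + F (w(i := 2)))"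
      by (rule mult_left_mono) simp
    moreover have "ennreal (1 / 2) * (2 * ennreal (Q (sqrt E))) = ennreal (Q (sqrt E))"
      using ennreal_mult[of "1 / 2" "2 * Q (sqrt E)"] ennreal_mult[of 2 "Q (sqrt E)"] Q_nonneg[of "sqrt E"]
      by simp
    moreover have "(\<integral>\<^sup>+m. F (w(i := m)) \<partial>?U) = ennreal (1 / 2) * (F (w(i := 1)) + F (w(i := 2)))"
    proof -
      have "{1..2} = {1, 2::nat}" by auto
      then show ?thesis
        unfolding uniform_count_measure_def
        by (simp add: nn_integral_point_measure_finite distrib_left del: One_nat_def)
    qed
    ultimately show ?thesis by (simp only:)
  qed
  \<comment> \<open>Integrating the conditional bound over the other messages and reinserting
    coordinate \<open>i\<close> recovers the average over all messages.\<close>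
  have "ennreal (Q (sqrt E)) = (\<integral>\<^sup>+w. ennreal (Q (sqrt E)) \<partial>PiM ({1..k} - {i}) (\<lambda>_. ?U))"
    using prob_space.emeasure_space_1[OF prob_space_PiM[of "{1..k} - {i}" "\<lambda>_. ?U"]] uniform.M.prob_space_axioms
    by simp
  also have "\<dots> \<le> (\<integral>\<^sup>+w. (\<integral>\<^sup>+m. F (w(i := m)) \<partial>?U) \<partial>PiM ({1..k} - {i}) (\<lambda>_. ?U))"
    by (rule nn_integral_mono) (rule F_ge)
  also have "\<dots> = (\<integral>\<^sup>+w. F w \<partial>message_space k 2)"
    using measurable_conditional_error[OF g i, of x]
    unfolding message_space_def F_def[symmetric]
    by (subst uniform.product_nn_integral_insert[of "{1..k} - {i}" i, unfolded insert, symmetric]) auto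
  also have "\<dots> = emeasure (channel_space n k 2) (error_event n k 2 x g i)"
    unfolding F_def by (rule emeasure_error_event[OF g i, symmetric])
  finally show ?thesis
    by (simp add: channel.emeasure_eq_measure)
qed

text \<open>With no users the average error is 0 and the bound would fail, hence
  \<open>k \<ge> 1\<close>.\<close>

lemma average_error_prob_ge:
  assumes "is_code n k 2 E x g" "k \<ge> 1"
  shows "Q (sqrt E) \<le> average_error_prob n k 2 x g"
proof -
  have "(\<Sum>i=1..k. Q (sqrt E)) \<le> (\<Sum>i=1..k. measure (channel_space n k 2) (error_event n k 2 x g i))"
    using assms by (intro sum_mono user_error_ge)
  then show ?thesis
    using assms by (simp add: average_error_prob_def error_event_def field_simps)
qed

section \<open>Achievability: antipodal signals on separate coordinates\<close>

lemma antipodal_code: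
  fixes s :: real
  assumes "k \<le> n" "s \<ge> 0"
  shows "\<exists>x g. is_code n k 2 (s\<^sup>2) x g \<and> average_error_prob n k 2 x g \<le> Q s"
proof -
  define x :: "nat \<Rightarrow> nat \<Rightarrow> nat \<Rightarrow> real" where
    "x i m t = (if t = i then if m = 1 then s else - s else 0)" for i m t
  define g :: "(nat \<Rightarrow> real) \<Rightarrow> nat \<Rightarrow> nat" where
    "g y = (\<lambda>i\<in>{1..k}. if y i > 0 then 1 else 2)" for y
  let ?N = "noise_space n"
  have g: "g \<in> measurable (PiM {1..n} (\<lambda>_. borel)) (PiM {1..k} (\<lambda>_. count_space {1..2}))"
    unfolding g_def
  proof (rule measurable_restrict)
    fix i assume "i \<in> {1..k}"
    then have "i \<in> {1..n}" using assms by auto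
    note [measurable] = measurable_component_singleton[OF this, of "\<lambda>_. borel :: real measure"]
    show "(\<lambda>y. if y i > 0 then 1 else 2) \<in> measurable (PiM {1..n} (\<lambda>_. borel :: real measure)) (count_space {1..2::nat})"
      by measurable
  qed
  have energy: "(\<Sum>t=1..n. (x i m t)\<^sup>2) = s\<^sup>2" if "i \<in> {1..k}" for i m
  proof -
    have "(\<Sum>t=1..n. (x i m t)\<^sup>2) = (\<Sum>t=1..n. if t = i then s\<^sup>2 else 0)"
      by (intro sum.cong) (auto simp: x_def)
    then show ?thesis using that assms by simp
  qed
  have err: "measure (channel_space n k 2) (error_event n k 2 x g i) \<le> Q s" if i: "i \<in> {1..k}" for i
  proof -
    have i_n: "i \<in> {1..n}" using i assms by auto
    have coord: "emeasure ?N {z \<in> space ?N. z i \<in> B} = ennreal (measure std_normal_distribution B)"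
      if "B \<in> sets borel" for B
      using std_normal_prod.emeasure_PiM_Collect_single[OF i_n, of B] that
      by (simp add: noise_space_def std_normal.emeasure_eq_measure)
    \<comment> \<open>All other users send 0 in coordinate \<open>i\<close>, so user
      \<open>i\<close> sees no interference there.\<close>
    have rec: "received n k x w z i = x i (w i) i + z i" for w z
    proof -
      have "(\<Sum>j=1..k. x j (w j) i) = (\<Sum>j=1..k. if j = i then x i (w i) i else 0)"
        by (intro sum.cong) (auto simp: x_def)
      then show ?thesis using i i_n by (simp add: received_def)
    qed
    have "emeasure ?N {z \<in> space ?N. g (received n k x w z) i \<noteq> w i} \<le> ennreal (Q s)"
      if "w \<in> space (message_space k 2)" for w
    proof -
      have "w i \<in> {1..2}"
        using measurable_space[OF measurable_message_component[OF i] that] by simp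
      then consider "w i = 1" | "w i = 2" by fastforce
      then show ?thesis
      proof cases
        case 1
        \<comment> \<open>Message 1 is sent as \<open>s\<close>, so the decoder errs exactly when
          \<open>s + z i \<le> 0\<close>; by symmetry of the noise this has probability
          \<open>Q s\<close>.\<close>
        then have "{z \<in> space ?N. g (received n k x w z) i \<noteq> w i} = {z \<in> space ?N. z i \<in> {..- s}}"
          using i by (auto simp: g_def rec x_def)
        then show ?thesis by (simp only: coord[OF atMost_borel] measure_std_normal_atMost minus_minus)
      next
        case 2
        then have "{z \<in> space ?N. g (received n k x w z) i \<noteq> w i} = {z \<in> space ?N. z i \<in> {s<..}}"
          using i by (auto simp: g_def rec x_def)
        then show ?thesis by (simp only: coord[OF greaterThan_borel] Q_def)
      qed
    qed
    then have "emeasure (channel_space n k 2) (error_event n k 2 x g i) \<le> (\<integral>\<^sup>+w. ennreal (Q s) \<partial>message_space k 2)"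
      unfolding emeasure_error_event[OF g i] by (rule nn_integral_mono)
    also have "\<dots> = ennreal (Q s)"
      by (simp add: message.emeasure_space_1)
    finally show ?thesis
      using Q_nonneg by (simp add: channel.emeasure_eq_measure)
  qed
  have "(\<Sum>i=1..k. measure (channel_space n k 2) (error_event n k 2 x g i)) \<le> (\<Sum>i=1..k. Q s)"
    by (intro sum_mono err)
  then have "average_error_prob n k 2 x g \<le> Q s"
    \<comment> \<open>For \<open>k = 0\<close> the average is 0, which is why only an inequality is
      claimed.\<close>
    using Q_nonneg[of s] by (cases "k = 0") (simp_all add: average_error_prob_def error_event_def field_simps)
  moreover have "is_code n k 2 (s\<^sup>2) x g"
    using g energy by (simp add: is_code_def)
  ultimately show ?thesis by blast
qed

text \<open>The second conjunct shows that the value does not hinge on how \<open>E_star\<close>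
  treats the blocklength: at each single blocklength with at least one user it is already the
  minimum.\<close>

theorem mainTheorem8:
  fixes \<mu> \<epsilon> :: real
  assumes "0 < \<mu>" and "\<mu> \<le> 1" and "0 < \<epsilon>" and "\<epsilon> < 1"
  shows "E_star 2 \<mu> \<epsilon> = (max 0 (Q_inv \<epsilon>))\<^sup>2 \<and>
    (\<forall>n. num_users \<mu> n \<ge> 1 \<longrightarrow>
       (max 0 (Q_inv \<epsilon>))\<^sup>2 \<in> attainable_energy_per_bit n (num_users \<mu> n) 2 \<epsilon> \<and>
       (\<forall>e \<in> attainable_energy_per_bit n (num_users \<mu> n) 2 \<epsilon>. (max 0 (Q_inv \<epsilon>))\<^sup>2 \<le> e))"
proof -
  \<comment> \<open>For \<open>\<epsilon> \<ge> 1/2\<close> the inverse is at most 0 and zero energy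
    suffices, because guessing errs with probability \<open>Q 0 = 1/2\<close>; the truncation at 0
    covers this case.\<close>
  define s where "s = max 0 (Q_inv \<epsilon>)"
  have Q_s: "Q s \<le> \<epsilon>"
    using Q_Q_inv[OF assms(3,4)] Q_le_iff[of s "Q_inv \<epsilon>"] by (simp add: s_def)
  \<comment> \<open>For two messages \<open>log 2 2 = 1\<close>, so energy and energy-per-bit
    coincide. The hypothesis \<open>\<mu> \<le> 1\<close> gives each user its own
    coordinate.\<close>
  have attainable: "s\<^sup>2 \<in> attainable_energy_per_bit n (num_users \<mu> n) 2 \<epsilon>" for n
  proof -
    have "\<mu> * real n \<le> real n" using assms by (simp add: mult_left_le_one_le)
    then have "num_users \<mu> n \<le> n" unfolding num_users_def by linarith
    then show ?thesis
      using antipodal_code[of "num_users \<mu> n" n s] Q_s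
      by (fastforce simp: attainable_energy_per_bit_def s_def)
  qed
  have optimal: "s\<^sup>2 \<le> e"
    if e: "e \<in> attainable_energy_per_bit n k 2 \<epsilon>" and k: "k \<ge> 1" for e n k
  proof -
    obtain x g where code: "is_code n k 2 e x g" and err: "average_error_prob n k 2 x g \<le> \<epsilon>"
      using e by (auto simp: attainable_energy_per_bit_def)
    \<comment> \<open>Any one codeword of user 1 forces \<open>e \<ge> 0\<close>, which is needed to
      recover \<open>e\<close> as the square of \<open>sqrt e\<close>.\<close>
    have "(\<Sum>t=1..n. (x 1 1 t)\<^sup>2) \<le> e" using code k by (auto simp: is_code_def)
    moreover have "(\<Sum>t=1..n. (x 1 1 t)\<^sup>2) \<ge> 0" by (simp add: sum_nonneg)
    ultimately have "e \<ge> 0" by linarith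
    have "Q (sqrt e) \<le> Q (Q_inv \<epsilon>)"
      using average_error_prob_ge[OF code k] err Q_Q_inv[OF assms(3,4)] by simp
    then have "s \<le> sqrt e" using \<open>e \<ge> 0\<close> by (simp add: Q_le_iff s_def)
    then have "s\<^sup>2 \<le> (sqrt e)\<^sup>2" by (rule power_mono) (simp add: s_def)
    then show ?thesis using \<open>e \<ge> 0\<close> by simp
  qed
  \<comment> \<open>Rounding down may leave no users at small blocklengths, where every real
    \<open>e\<close> is vacuously attainable; from \<open>1 / \<mu>\<close> onwards there is at
    least one.\<close>
  have users: "\<forall>\<^sub>F n in sequentially. num_users \<mu> n \<ge> 1"
    unfolding eventually_sequentially
  proof (intro exI allI impI)
    fix n assume "n \<ge> nat \<lceil>1 / \<mu>\<rceil>"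
    then have "1 / \<mu> \<le> real n" by linarith
    then have "\<mu> * real n \<ge> 1" using assms by (simp add: field_simps)
    then show "num_users \<mu> n \<ge> 1" unfolding num_users_def by linarith
  qed
  have "E_star 2 \<mu> \<epsilon> = s\<^sup>2"
    unfolding E_star_def
  proof (rule cInf_eq_minimum)
    show "s\<^sup>2 \<in> {e. \<forall>\<^sub>F n in sequentially. e \<in> attainable_energy_per_bit n (num_users \<mu> n) 2 \<epsilon>}"
      using attainable by simp
    fix e assume "e \<in> {e. \<forall>\<^sub>F n in sequentially. e \<in> attainable_energy_per_bit n (num_users \<mu> n) 2 \<epsilon>}"
    \<comment> \<open>One blocklength that has a user and at which \<open>e\<close> is attainable
      suffices, since the lower bound holds at each such blocklength.\<close>
    then have "\<forall>\<^sub>F n in sequentially. e \<in> attainable_energy_per_bit n (num_users \<mu> n) 2 \<epsilon> \<and> num_users \<mu> n \<ge> 1"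
      using users by (simp add: eventually_conj)
    then obtain n where "e \<in> attainable_energy_per_bit n (num_users \<mu> n) 2 \<epsilon>" "num_users \<mu> n \<ge> 1"
      using eventually_happens'[OF sequentially_bot] by blast
    then show "s\<^sup>2 \<le> e" by (rule optimal)
  qed
  then show ?thesis
    using attainable optimal by (simp add: s_def)
qed

end
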